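(* Let $S$ be a numerical semigroup with Frobenius number $F(S)$, let $I \subseteq M(S)$, and let $T = I \cup S$. Then $T$ is a numerical set associated to $S$ (i.e. $A(T)=S$) if and only if both of the following hold: (1) $I$ is an order ideal of the void poset $(M(S),\preccurlyeq)$; and (2) for each $P \in I \cap PF(S)$, at least one of the following conditions is satisfied: $2P \notin S$; or $F(S)-P \in I$; or there is a Frobenius triangle $(P,x,y)$ of $S$ that is satisfied by $I$. Moreover, if $I \cup S$ is a numerical set associated to $S$, then for all $P \in I \cap PF(S)$ either $F(S)-P \in I$ or there is a Frobenius triangle $(P,x,y)$ of $S$ that is satisfied by $I$.
   Context: A numerical set $T$ is a subset of $\mathbb{N}_0=\{0,1,2,\dots\}$ containing $0$ with finite complement; elements of $\mathbb{N}_0\setminus T$ are its gaps, and its Frobenius number $F(T)$ is the largest gap (defined when $T\ne\mathbb{N}_0$, so here $S\neq \mathbb{N}_0$). A numerical semigroup is a numerical set closed under addition. The atom monoid of $T$ is $A(T)=\{x\in\mathbb{N}_0 \mid x+T\subseteq T\}$; $T$ is associated to $S$ if $A(T)=S$. The pseudo-Frobenius numbers of $S$ are $PF(S)=\{P\in \mathbb{N}_0\setminus S \mid P+s\in S \text{ for all } s\in S\setminus\{0\}\}$. The void of $S$ is $M(S)=\{a\in\mathbb{N}_0 \mid a\notin S,\ F(S)-a\notin S, \ a \le F(S)\}$ (the gaps $a$ such that $F(S)-a$ is also a gap), partially ordered by $x\preccurlyeq y$ iff $y-x\in S$; this is the void poset. A subset $I\subseteq M(S)$ is an order ideal if $x\in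 I$, $y\in M(S)$, $x\preccurlyeq y$ imply $y\in I$ (upward closed). A Frobenius triangle of $S$ is a triple $(P,x,y)\in PF(S)\times M(S)^2$ with $P+x+y=F(S)$. An order ideal $I$ satisfies the Frobenius triangle $(P,x,y)$ if $P\in I$, $x\in I$ and $F(S)-y\notin I$. *)

theory Defs
  imports Main
begin

definition numerical_set :: "nat set \<Rightarrow> bool" where
  "numerical_set T \<longleftrightarrow> 0 \<in> T \<and> finite (UNIV - T)"

definition numerical_semigroup :: "nat set \<Rightarrow> bool" where
  "numerical_semigroup S \<longleftrightarrow> numerical_set S \<and> (\<forall>x\<in>S. \<forall>y\<in>S. x + y \<in> S)"

(* Meaningful only for a numerical set T \<noteq> UNIV: Max of the empty set is unspecified. *)
definition frobenius :: "nat set \<Rightarrow> nat" where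
  "frobenius T = Max (UNIV - T)"

definition atom_monoid :: "nat set \<Rightarrow> nat set" where
  "atom_monoid T = {x. (\<lambda>t. x + t) ` T \<subseteq> T}"

definition associated :: "nat set \<Rightarrow> nat set \<Rightarrow> bool" where
  "associated T S \<longleftrightarrow> numerical_set T \<and> atom_monoid T = S"

definition pseudo_frobenius :: "nat set \<Rightarrow> nat set" where
  "pseudo_frobenius S = {P. P \<notin> S \<and> (\<forall>s\<in>S - {0}. P + s \<in> S)}"

(* The conditions a \<le> frobenius S here and x \<le> y in void_le ensure that the
   subtraction on nat is not truncated. *)
definition void :: "nat set \<Rightarrow> nat set" where
  "void S = {a. a \<notin> S \<and> a \<le> frobenius S \<and> frobenius S - a \<notin> S}"

definition void_le :: "nat set \<Rightarrow> nat \<Rightarrow> nat \<Rightarrow> bool" where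
  "void_le S x y \<longleftrightarrow> x \<le> y \<and> y - x \<in> S"

(* Order ideals are upward closed. *)
definition order_ideal :: "nat set \<Rightarrow> nat set \<Rightarrow> bool" where
  "order_ideal S I \<longleftrightarrow>
     I \<subseteq> void S \<and> (\<forall>x\<in>I. \<forall>y\<in>void S. void_le S x y \<longrightarrow> y \<in> I)"

definition frobenius_triangle :: "nat set \<Rightarrow> nat \<times> nat \<times> nat \<Rightarrow> bool" where
  "frobenius_triangle S = (\<lambda>(P, x, y).
     P \<in> pseudo_frobenius S \<and> x \<in> void S \<and> y \<in> void S \<and> P + x + y = frobenius S)"

(* For a Frobenius triangle, y \<in> void S, so frobenius S - y is not truncated. *)
definition satisfies_triangle :: "nat set \<Rightarrow> nat set \<Rightarrow> nat \<times> nat \<times> nat \<Rightarrow> bool" where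
  "satisfies_triangle S I = (\<lambda>(P, x, y). P \<in> I \<and> x \<in> I \<and> frobenius S - y \<notin> I)"

end

theory Submission imports Defs begin

text \<open>
  The set \<open>I\<close> is an order ideal exactly when \<open>S \<subseteq> A(T)\<close>. If \<open>A(T)\<close> is strictly larger than \<open>S\<close>,
  let \<open>P\<close> be the largest element of \<open>A(T) - S\<close>. Since \<open>A(T)\<close> is a monoid containing \<open>S\<close>, both
  \<open>P + s\<close> (for \<open>0 \<noteq> s \<in> S\<close>) and \<open>2P\<close> lie in \<open>A(T)\<close> and exceed \<open>P\<close>, hence lie in \<open>S\<close>; so \<open>P\<close> is
  pseudo-Frobenius with \<open>2P \<in> S\<close>. It then suffices to see that, for \<open>P \<in> I \<inter> PF(S)\<close>, a witness
  \<open>t\<close> of \<open>P \<notin> A(T)\<close> is either \<open>F(S) - P\<close> or yields the triangle \<open>(P, t, F(S) - P - t)\<close>.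
\<close>

lemma le_frobenius:
  assumes "numerical_set S" "x \<notin> S"
  shows "x \<le> frobenius S"
  using assms by (simp add: numerical_set_def frobenius_def)

lemma frobenius_notin:
  assumes "numerical_set S" "S \<noteq> UNIV"
  shows "frobenius S \<notin> S"
  using Max_in[of "UNIV - S"] assms by (auto simp: numerical_set_def frobenius_def)

lemma numerical_set_Un:
  assumes "numerical_set S"
  shows "numerical_set (I \<union> S)"
  using assms by (auto simp: numerical_set_def intro: finite_subset[of _ "UNIV - S"])

lemma atom_monoid_iff: "x \<in> atom_monoid T \<longleftrightarrow> (\<forall>t\<in>T. x + t \<in> T)"
  by (auto simp: atom_monoid_def)

lemma atom_monoid_add:
  assumes "x \<in> atom_monoid T" "y \<in> atom_monoid T"
  shows "x + y \<in> atom_monoid T"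
  using assms by (simp add: atom_monoid_iff add.assoc)

lemma atom_monoid_subset:
  assumes "0 \<in> T"
  shows "atom_monoid T \<subseteq> T"
  using assms by (force simp: atom_monoid_iff)

context
  fixes S I :: "nat set"
  assumes S: "numerical_semigroup S" and ne: "S \<noteq> UNIV" and I: "I \<subseteq> void S"
begin

private lemma set_S: "numerical_set S"
  using S by (simp add: numerical_semigroup_def)

private lemma zero: "0 \<in> S"
  using set_S by (simp add: numerical_set_def)

private lemma add_S: "x \<in> S \<Longrightarrow> y \<in> S \<Longrightarrow> x + y \<in> S"
  using S by (simp add: numerical_semigroup_def)

text \<open>The complement of \<open>F(S)\<close> is \<open>0\<close>, which lies in
  \<open>S\<close>, so \<open>F(S)\<close> cannot be in the void.\<close>

private lemma frobenius_notin_Un: "frobenius S \<notin> I \<union> S"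
  using frobenius_notin[OF set_S ne] I zero by (auto simp: void_def)

text \<open>If \<open>F(S) - (x + s)\<close> were in \<open>S\<close>, adding \<open>s\<close> would
  put \<open>F(S) - x\<close> in \<open>S\<close>. So a translate of a void element by
  \<open>S\<close> can leave the void only by entering \<open>S\<close>.\<close>

lemma void_add:
  assumes x: "x \<in> void S" and s: "s \<in> S" and xs: "x + s \<notin> S"
  shows "x + s \<in> void S"
proof -
  have le: "x + s \<le> frobenius S" using le_frobenius[OF set_S xs] .
  have "frobenius S - (x + s) \<notin> S"
  proof
    assume "frobenius S - (x + s) \<in> S"
    then have "(frobenius S - (x + s)) + s \<in> S" using s by (rule add_S)
    moreover have "(frobenius S - (x + s)) + s = frobenius S - x" using le by simp
    ultimately show False using x by (simp add: void_def)
  qed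
  then show ?thesis using xs le by (simp add: void_def)
qed

lemma order_ideal_iff_subset_atom_monoid:
  "order_ideal S I \<longleftrightarrow> S \<subseteq> atom_monoid (I \<union> S)"
proof
  assume oi: "order_ideal S I"
  have "s + t \<in> I \<union> S" if s: "s \<in> S" and t: "t \<in> I \<union> S" for s t
  \<comment> \<open>In the remaining case \<open>t\<close> is in \<open>I\<close> and
    \<open>s + t\<close> is a gap, hence a void element above \<open>t\<close>, and upward closure
    applies.\<close>
  proof (cases "t \<in> S \<or> s + t \<in> S")
    case True
    then show ?thesis using add_S s by blast
  next
    case False
    then have tI: "t \<in> I" using t by simp
    have "t + s \<in> void S" using False tI I s by (intro void_add) (auto simp: add.commute)
    moreover have "void_le S t (t + s)" using s by (simp add: void_le_def)
    ultimately have "t + s \<in> I" using oi tI unfolding order_ideal_def by blast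
    then show ?thesis by (simp add: add.commute)
  qed
  then show "S \<subseteq> atom_monoid (I \<union> S)" by (auto simp: atom_monoid_iff)
next
  assume sub: "S \<subseteq> atom_monoid (I \<union> S)"
  have "y \<in> I" if "x \<in> I" "y \<in> void S" "void_le S x y" for x y
  proof -
    have "y - x \<in> atom_monoid (I \<union> S)" using that sub by (auto simp: void_le_def)
    then have "(y - x) + x \<in> I \<union> S" using that by (simp add: atom_monoid_iff)
    then show ?thesis using that by (auto simp: void_le_def void_def)
  qed
  then show "order_ideal S I" using I by (simp add: order_ideal_def)
qed

text \<open>A satisfied triangle says that \<open>P + x = F(S) - y\<close> leaves
  \<open>I \<union> S\<close> although \<open>x \<in> I\<close>, so \<open>x\<close> witnesses that
  \<open>P\<close> is no atom. The disjunct \<open>F(S) - P \<in> I\<close> is the degenerate case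
  \<open>y = 0\<close>, which is no triangle because \<open>0\<close> is not in the void.\<close>

lemma notin_atom_monoid_iff_triangle:
  assumes P: "P \<in> I" "P \<in> pseudo_frobenius S"
  shows "P \<notin> atom_monoid (I \<union> S) \<longleftrightarrow>
    frobenius S - P \<in> I \<or>
    (\<exists>x y. frobenius_triangle S (P, x, y) \<and> satisfies_triangle S I (P, x, y))"
proof
  assume "P \<notin> atom_monoid (I \<union> S)"
  then obtain t where t: "t \<in> I \<union> S" and Pt: "P + t \<notin> I \<union> S"
    by (auto simp: atom_monoid_iff)
  have "t \<noteq> 0" using Pt P by (intro notI) simp
  then have "t \<notin> S" using P Pt by (auto simp: pseudo_frobenius_def)
  then have tI: "t \<in> I" and tv: "t \<in> void S" using t I by auto
  have le: "P + t \<le> frobenius S" using le_frobenius[OF set_S] Pt by blast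
  show "frobenius S - P \<in> I \<or>
    (\<exists>x y. frobenius_triangle S (P, x, y) \<and> satisfies_triangle S I (P, x, y))"
  proof (cases "P + t = frobenius S")
    case True
    then have "frobenius S - P = t" by simp
    then show ?thesis using tI by simp
  next
    case False
    define y where "y = frobenius S - (P + t)"
    have sum: "P + t + y = frobenius S" and y0: "y \<noteq> 0" using le False by (auto simp: y_def)
    have Fy: "frobenius S - y = P + t" using sum by simp
    \<comment> \<open>Otherwise \<open>P\<close> being pseudo-Frobenius and
      \<open>y \<noteq> 0\<close> would put \<open>P + y = F(S) - t\<close> in \<open>S\<close>,
      although \<open>t\<close> is in the void.\<close>
    have "y \<notin> S"
    proof
      assume "y \<in> S"
      then have "P + y \<in> S" using P y0 by (auto simp: pseudo_frobenius_def)
      moreover have "P + y = frobenius S - t" using sum by simp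
      ultimately show False using tv by (simp add: void_def)
    qed
    then have "y \<in> void S" using Fy Pt sum by (simp add: void_def)
    then have "frobenius_triangle S (P, t, y)" "satisfies_triangle S I (P, t, y)"
      using P tv tI sum Fy Pt by (auto simp: frobenius_triangle_def satisfies_triangle_def)
    then show ?thesis by blast
  qed
next
  assume "frobenius S - P \<in> I \<or>
    (\<exists>x y. frobenius_triangle S (P, x, y) \<and> satisfies_triangle S I (P, x, y))"
  then show "P \<notin> atom_monoid (I \<union> S)"
  proof (elim disjE exE conjE)
    assume "frobenius S - P \<in> I"
    moreover have "P + (frobenius S - P) \<notin> I \<union> S"
      using frobenius_notin_Un P I by (auto simp: void_def)
    ultimately show ?thesis by (auto simp: atom_monoid_iff)
  next
    fix x y
    assume tri: "frobenius_triangle S (P, x, y)" and sat: "satisfies_triangle S I (P, x, y)"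
    have "P + x = frobenius S - y" using tri by (auto simp: frobenius_triangle_def)
    then have "P + x \<notin> I \<union> S" "x \<in> I"
      using tri sat by (auto simp: frobenius_triangle_def satisfies_triangle_def void_def)
    then show ?thesis by (auto simp: atom_monoid_iff)
  qed
qed

lemma exists_pseudo_frobenius_in_atom_monoid:
  assumes sub: "S \<subset> atom_monoid (I \<union> S)"
  shows "\<exists>P \<in> I \<inter> pseudo_frobenius S. P \<in> atom_monoid (I \<union> S) \<and> 2 * P \<in> S"
proof -
  define D where "D = atom_monoid (I \<union> S) - S"
  define P where "P = Max D"
  have fin: "finite D"
    using set_S by (auto simp: numerical_set_def D_def intro: finite_subset[of _ "UNIV - S"])
  have "D \<noteq> {}" using sub by (auto simp: D_def)
  with fin have "P \<in> D" unfolding P_def by (rule Max_in)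
  then have PA: "P \<in> atom_monoid (I \<union> S)" and PS: "P \<notin> S" by (auto simp: D_def)
  have above: "x \<in> S" if "x \<in> atom_monoid (I \<union> S)" "P < x" for x
    using Max_ge[OF fin, of x] that by (auto simp: D_def P_def)
  have "P \<in> I" using PA PS atom_monoid_subset[of "I \<union> S"] zero by auto
  moreover have "P + s \<in> S" if "s \<in> S" "s \<noteq> 0" for s
    using that PA sub by (intro above atom_monoid_add) auto
  then have "P \<in> pseudo_frobenius S" using PS by (simp add: pseudo_frobenius_def)
  \<comment> \<open>This makes \<open>P + P\<close> strictly larger than \<open>P\<close>, so that
    maximality applies to it.\<close>
  moreover have "P \<noteq> 0" using PS zero by (intro notI) simp
  then have "P + P \<in> S" using PA by (intro above atom_monoid_add) auto
  ultimately show ?thesis using PA by (auto simp: mult_2)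
qed

end

theorem theorem3p9:
  fixes S I T :: "nat set"
  assumes "numerical_semigroup S" and "S \<noteq> UNIV"
    and "I \<subseteq> void S" and "T = I \<union> S"
  shows "(associated T S \<longleftrightarrow>
            order_ideal S I \<and>
            (\<forall>P \<in> I \<inter> pseudo_frobenius S.
               2 * P \<notin> S \<or> frobenius S - P \<in> I \<or>
               (\<exists>x y. frobenius_triangle S (P, x, y) \<and> satisfies_triangle S I (P, x, y))))
         \<and> (associated T S \<longrightarrow>
            (\<forall>P \<in> I \<inter> pseudo_frobenius S.
               frobenius S - P \<in> I \<or>
               (\<exists>x y. frobenius_triangle S (P, x, y) \<and> satisfies_triangle S I (P, x, y))))"
proof -
  note ctxt = assms(1-3)
  define Q where "Q P \<longleftrightarrow> frobenius S - P \<in> I \<or>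
    (\<exists>x y. frobenius_triangle S (P, x, y) \<and> satisfies_triangle S I (P, x, y))" for P
  have assoc: "associated T S \<longleftrightarrow> atom_monoid (I \<union> S) = S"
    using assms(1,4) numerical_set_Un by (auto simp: associated_def numerical_semigroup_def)
  have Q: "P \<notin> atom_monoid (I \<union> S) \<longleftrightarrow> Q P" if "P \<in> I \<inter> pseudo_frobenius S" for P
    unfolding Q_def using notin_atom_monoid_iff_triangle[OF ctxt] that by blast
  have pf: "P \<notin> S" if "P \<in> pseudo_frobenius S" for P
    using that by (simp add: pseudo_frobenius_def)
  \<comment> \<open>When \<open>A(T) = S\<close>, the gap \<open>P\<close> lies outside
    \<open>A(T)\<close>. This is the final claim, and it also yields condition (2).\<close>
  have strong: "\<forall>P \<in> I \<inter> pseudo_frobenius S. Q P" if "associated T S"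
    using that Q pf unfolding assoc by blast
  moreover have "order_ideal S I" if "associated T S"
    using that order_ideal_iff_subset_atom_monoid[OF ctxt] unfolding assoc by blast
  \<comment> \<open>If the inclusion of \<open>S\<close> in \<open>A(T)\<close> were strict, there
    would be a pseudo-Frobenius \<open>P \<in> I\<close> in \<open>A(T)\<close> with
    \<open>2 * P \<in> S\<close>. Then \<open>Q P\<close> fails, against the hypothesis.\<close>
  moreover have "associated T S"
    if "order_ideal S I" "\<forall>P \<in> I \<inter> pseudo_frobenius S. 2 * P \<notin> S \<or> Q P"
    using that Q order_ideal_iff_subset_atom_monoid[OF ctxt]
      exists_pseudo_frobenius_in_atom_monoid[OF ctxt]
    unfolding assoc by blast
  ultimately show ?thesis unfolding Q_def[symmetric] by blast
qed

end
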